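(* Let $q$ be a positive integer and let $k \in \{4q-1, 4q, 4q+1, 4q+2\}$. Then $$ch^*_f(\mathcal{Q}_k) = 2 + \frac{1}{q},$$ where $\mathcal{Q}_k$ is the class of series-parallel graphs with girth at least $k$.
   Context: Colourings. For a graph $G$ and a positive integer $b$, a $b$-fold colouring of $G$ is a mapping $\phi$ assigning to each vertex $v$ a set $\phi(v)$ of $b$ colours so that adjacent vertices receive disjoint colour sets. An $a$-list assignment of $G$ is a mapping $L$ assigning to each vertex $v$ a set $L(v)$ of $a$ permissible colours. A $b$-fold $L$-colouring of $G$ is a $b$-fold colouring $\phi$ with $\phi(v)\subseteq L(v)$ for each vertex $v$. $G$ is $(a,b)$-choosable if for every $a$-list assignment $L$ of $G$ there is a $b$-fold $L$-colouring of $G$. Strong fractional choice number. For a real number $r$, $G$ is strongly fractional $r$-choosable if for every positive integer $m$, $G$ is $(\lceil rm\rceil, m)$-choosable. The strong fractional choice number of $G$ is $ch^*_f(G)=\inf\{r : G \text{ is strongly fractional } r\text{-choosable}\}$. For a class $\mathcal{G}$ of graphs, $ch^*_f(\mathcal{G})=\sup\{ch^*_f(G): G\in\mathcal{G}\}$. Series-parallel graphs. Two-terminal series-parallel graphs $(G;x,y)$ are defined recursively: (i) with $V(K_2)=\{0,1\}$, $(K_2;0,1)$ is one; (ii) (parallel construction) if $(G;x,y)$ and $(G';x',y')$ are vertex disjoint two-terminal series-parallel graphs, and $G''$ is obtained from the union of $G$ and $G'$ by identifying $x$ and $x'$ into a single vertex $x''$ and $y$ and $y'$ into a single vertex $y''$,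 then $(G'';x'',y'')$ is one; (iii) (series construction) if $(G;x,y)$ and $(G';x',y')$ are vertex disjoint two-terminal series-parallel graphs, and $G''$ is obtained from the union of $G$ and $G'$ by identifying $y$ and $x'$ into a single vertex $x''$, then $(G'';x,y')$ is one. A graph $G$ is series-parallel if there are two vertices $x,y$ such that $(G;x,y)$ is a two-terminal series-parallel graph. The girth of $G$ is the length of a shortest cycle (a pair of parallel edges counts as a cycle of length 2; an acyclic graph has infinite girth). *)

theory Defs
  imports "HOL-Library.Multiset" "HOL-Library.Extended_Nat" "HOL-Library.Extended_Real"
begin

text \<open>
  Undirected multigraphs: an edge is the set of its end vertices, and its multiplicity in
  \<open>edges\<close> is the number of parallel copies.
\<close>

record 'a mgraph =
  verts :: "'a set"
  edges :: "'a set multiset"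

definition union_mgraph :: "'a mgraph \<Rightarrow> 'a mgraph \<Rightarrow> 'a mgraph" where
  "union_mgraph G G' = \<lparr>verts = verts G \<union> verts G', edges = edges G + edges G'\<rparr>"

text \<open>
  The image of a multigraph under a vertex map; vertices with the same image are identified,
  and no edge is lost (edges that become parallel are counted with multiplicity).
\<close>

definition image_mgraph :: "('a \<Rightarrow> 'b) \<Rightarrow> 'a mgraph \<Rightarrow> 'b mgraph" where
  "image_mgraph f G = \<lparr>verts = f ` verts G, edges = image_mset ((`) f) (edges G)\<rparr>"

text \<open>
  Two-terminal series-parallel graphs. Graphs are meant up to isomorphism, so the base case
  admits \<open>K\<^sub>2\<close> on any two distinct vertices, and the vertex obtained by identifying \<open>x\<close> with
  \<open>x'\<close> keeps the name \<open>x\<close>. On an infinite vertex type this family is closed under isomorphism.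
\<close>

inductive two_terminal_sp :: "'a mgraph \<Rightarrow> 'a \<Rightarrow> 'a \<Rightarrow> bool" where
  K2: "x \<noteq> y \<Longrightarrow> two_terminal_sp \<lparr>verts = {x, y}, edges = {#{x, y}#}\<rparr> x y"
| parallel: "two_terminal_sp G x y \<Longrightarrow> two_terminal_sp G' x' y' \<Longrightarrow> verts G \<inter> verts G' = {} \<Longrightarrow>
    two_terminal_sp (image_mgraph (id(x' := x, y' := y)) (union_mgraph G G')) x y"
| series: "two_terminal_sp G x y \<Longrightarrow> two_terminal_sp G' x' y' \<Longrightarrow> verts G \<inter> verts G' = {} \<Longrightarrow>
    two_terminal_sp (image_mgraph (id(x' := y)) (union_mgraph G G')) x y'"

definition series_parallel :: "'a mgraph \<Rightarrow> bool" where
  "series_parallel G \<longleftrightarrow> (\<exists>x y. two_terminal_sp G x y)"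

text \<open>
  A cycle is given by its cyclic sequence of distinct vertices. As the edges used are compared
  with \<open>edges G\<close> as multisets, a sequence of two vertices is a cycle iff the two vertices are
  joined by at least two parallel edges.
\<close>

definition cycle_edges :: "'a list \<Rightarrow> 'a set multiset" where
  "cycle_edges vs = {# {vs ! i, vs ! (Suc i mod length vs)}. i \<in># mset [0..<length vs] #}"

definition is_cycle :: "'a mgraph \<Rightarrow> 'a list \<Rightarrow> bool" where
  "is_cycle G vs \<longleftrightarrow>
     vs \<noteq> [] \<and> distinct vs \<and> set vs \<subseteq> verts G \<and> cycle_edges vs \<subseteq># edges G"

definition girth :: "'a mgraph \<Rightarrow> enat" where
  "girth G = (INF vs \<in> {vs. is_cycle G vs}. enat (length vs))"

definition adjacent :: "'a mgraph \<Rightarrow> 'a \<Rightarrow> 'a \<Rightarrow> bool" where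
  "adjacent G u v \<longleftrightarrow> {u, v} \<in># edges G"

definition fold_colouring :: "'a mgraph \<Rightarrow> nat \<Rightarrow> ('a \<Rightarrow> 'c set) \<Rightarrow> bool" where
  "fold_colouring G b \<phi> \<longleftrightarrow>
     (\<forall>v\<in>verts G. finite (\<phi> v) \<and> card (\<phi> v) = b) \<and>
     (\<forall>u\<in>verts G. \<forall>v\<in>verts G. adjacent G u v \<longrightarrow> \<phi> u \<inter> \<phi> v = {})"

definition list_assignment :: "'a mgraph \<Rightarrow> nat \<Rightarrow> ('a \<Rightarrow> 'c set) \<Rightarrow> bool" where
  "list_assignment G a L \<longleftrightarrow> (\<forall>v\<in>verts G. finite (L v) \<and> card (L v) = a)"

definition fold_list_colouring ::
    "'a mgraph \<Rightarrow> nat \<Rightarrow> ('a \<Rightarrow> 'c set) \<Rightarrow> ('a \<Rightarrow> 'c set) \<Rightarrow> bool" where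
  "fold_list_colouring G b L \<phi> \<longleftrightarrow> fold_colouring G b \<phi> \<and> (\<forall>v\<in>verts G. \<phi> v \<subseteq> L v)"

text \<open>Colours are natural numbers; for finite graphs any infinite supply of colours would do.\<close>

definition choosable :: "'a mgraph \<Rightarrow> nat \<Rightarrow> nat \<Rightarrow> bool" where
  "choosable G a b \<longleftrightarrow>
     (\<forall>L :: 'a \<Rightarrow> nat set. list_assignment G a L \<longrightarrow> (\<exists>\<phi>. fold_list_colouring G b L \<phi>))"

text \<open>
  For \<open>r \<le> 0\<close> the truncation by \<open>nat\<close> makes all lists empty, so no graph with a vertex is
  strongly fractional \<open>r\<close>-choosable.
\<close>

definition strongly_fractional_choosable :: "'a mgraph \<Rightarrow> real \<Rightarrow> bool" where
  "strongly_fractional_choosable G r \<longleftrightarrow> (\<forall>m::nat. m > 0 \<longrightarrow> choosable G (nat \<lceil>r * real m\<rceil>) m)"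

text \<open>
  Infimum and supremum are taken in the extended reals, where they exist without
  side conditions on boundedness or nonemptiness.
\<close>

definition strong_fractional_choice_number :: "'a mgraph \<Rightarrow> ereal" where
  "strong_fractional_choice_number G = (INF r \<in> {r. strongly_fractional_choosable G r}. ereal r)"

definition class_strong_fractional_choice_number :: "'a mgraph set \<Rightarrow> ereal" where
  "class_strong_fractional_choice_number \<G> = (SUP G \<in> \<G>. strong_fractional_choice_number G)"

text \<open>
  Series-parallel graphs are finite, so the vertex type \<open>nat\<close> represents all of them up to
  isomorphism.
\<close>

definition sp_girth_class :: "nat \<Rightarrow> nat mgraph set" where
  "sp_girth_class k = {G. series_parallel G \<and> girth G \<ge> enat k}"

end

theory Submission
  imports Defs "HOL-Library.Nat_Bijection"
begin

text \<open>
  The value is the threshold at which a long path stops being flexible. Write the list size as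
  \<open>2 * m + e\<close> and follow a path whose first vertex has already received its \<open>m\<close> colours. The second
  vertex must avoid \<open>m\<close> given colours, and each further pair of vertices relaxes this restriction
  by \<open>e\<close>: after an odd number of steps there is a set \<open>W\<close> of \<open>m\<close> colours such that the choices
  compatible with the beginning include all those that meet \<open>W\<close> in at most \<open>t\<close> colours, where \<open>t\<close>
  grows by \<open>e\<close> with every two steps. After \<open>2 * q\<close> steps nothing is left of the restriction
  if \<open>m \<le> q * e\<close>, so both ends of a path with at least \<open>2 * q\<close> edges can be prescribed
  (\<open>path_extension\<close>). If \<open>q * e < m\<close>, suitable lists make these estimates tight, and on a path with
  \<open>2 * q + 1\<close> edges the prescription of two given sets at the ends fails.

  For the upper bound, a series-parallel graph is a path or arises from a smaller one by attaching
  an ear to two of its vertices which a path of the smaller graph, no longer than the ear,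
  already joins (\<open>glued_sp_path_or_long_ear\<close>). These two paths form a cycle, so girth at least \<open>4 * q - 1\<close>
  forces the ear to have at least \<open>2 * q\<close> edges, and a colouring of the smaller graph extends. With
  \<open>r = 2 + 1 / q\<close> the lists have size \<open>2 * m + e\<close> where \<open>e\<close> is \<open>m / q\<close> rounded up, hence
  \<open>m \<le> q * e\<close>.

  For the lower bound, join two vertices by threads with \<open>2 * q + 1\<close> edges, one thread for each pair
  of sets of \<open>m\<close> colours from the lists of the two vertices, with lists on that thread which
  exclude this pair (\<open>theta_graph_not_choosable\<close>). A cycle consists of two threads, so the girth is
  at least \<open>4 * q + 2\<close>. With \<open>e = M\<close> and
  \<open>m = q * M + 1\<close> the ratio \<open>(2 * m + e) / m\<close> tends to \<open>2 + 1 / q\<close>.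
\<close>

section \<open>Gluing subgraphs instead of identifying vertices\<close>

text \<open>
  Two-terminal series-parallel graphs composed of subgraphs that already share their terminals.
  Decompositions then live inside one fixed graph, so that lists, colourings and paths need not be
  transported along identification maps.
\<close>

inductive glued_sp :: "'a mgraph \<Rightarrow> 'a \<Rightarrow> 'a \<Rightarrow> bool" where
  edge: "x \<noteq> y \<Longrightarrow> glued_sp \<lparr>verts = {x, y}, edges = {#{x, y}#}\<rparr> x y"
| parallel: "glued_sp G x y \<Longrightarrow> glued_sp G' x y \<Longrightarrow> verts G \<inter> verts G' = {x, y} \<Longrightarrow>
    glued_sp (union_mgraph G G') x y"
| series: "glued_sp G x y \<Longrightarrow> glued_sp G' y z \<Longrightarrow> verts G \<inter> verts G' = {y} \<Longrightarrow>
    glued_sp (union_mgraph G G') x z"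

lemma union_mgraph_sel [simp]:
  "verts (union_mgraph G G') = verts G \<union> verts G'"
  "edges (union_mgraph G G') = edges G + edges G'"
  by (simp_all add: union_mgraph_def)

lemma image_mgraph_sel [simp]:
  "verts (image_mgraph f G) = f ` verts G"
  "edges (image_mgraph f G) = image_mset ((`) f) (edges G)"
  by (simp_all add: image_mgraph_def)

lemma union_mgraph_commute: "union_mgraph G G' = union_mgraph G' G"
  by (simp add: union_mgraph_def Un_commute add.commute)

lemma union_mgraph_right_commute:
  "union_mgraph (union_mgraph G G') G'' = union_mgraph (union_mgraph G G'') G'"
  by (simp add: union_mgraph_def Un_ac add.assoc add.commute)

lemma image_mgraph_union:
  "image_mgraph f (union_mgraph G G') = union_mgraph (image_mgraph f G) (image_mgraph f G')"
  by (simp add: image_mgraph_def union_mgraph_def image_Un)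

lemma image_mgraph_comp: "image_mgraph f (image_mgraph g G) = image_mgraph (f \<circ> g) G"
  by (simp add: image_mgraph_def image_comp multiset.map_comp comp_def)

lemma image_mgraph_cong:
  assumes "\<And>v. v \<in> verts G \<Longrightarrow> f v = g v" "\<forall>e \<in># edges G. e \<subseteq> verts G"
  shows "image_mgraph f G = image_mgraph g G"
proof -
  have "image_mset ((`) f) (edges G) = image_mset ((`) g) (edges G)"
    using assms by (intro image_mset_cong image_cong) auto
  then show ?thesis
    using assms(1) by (simp add: image_mgraph_def)
qed

lemma image_mgraph_id [simp]: "image_mgraph id G = G"
  by (simp add: image_mgraph_def)

lemma image_mgraph_ident:
  assumes "\<And>v. v \<in> verts G \<Longrightarrow> f v = v" "\<forall>e \<in># edges G. e \<subseteq> verts G"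
  shows "image_mgraph f G = G"
proof -
  have "image_mgraph f G = image_mgraph id G"
    using assms by (intro image_mgraph_cong) auto
  then show ?thesis by simp
qed

lemma glued_sp_basic:
  assumes "glued_sp G x y"
  shows "finite (verts G)" "x \<in> verts G" "y \<in> verts G" "x \<noteq> y" "\<forall>e \<in># edges G. e \<subseteq> verts G"
proof -
  have "finite (verts G) \<and> x \<in> verts G \<and> y \<in> verts G \<and> x \<noteq> y \<and> (\<forall>e \<in># edges G. e \<subseteq> verts G)"
    using assms by induction auto
  then show "finite (verts G)" "x \<in> verts G" "y \<in> verts G" "x \<noteq> y" "\<forall>e \<in># edges G. e \<subseteq> verts G"
    by blast+
qed

lemma glued_sp_image:
  assumes "glued_sp G x y" "inj_on f (verts G)"
  shows "glued_sp (image_mgraph f G) (f x) (f y)"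
  using assms
proof induction
  case (edge x y)
  then have "f x \<noteq> f y" by (auto dest: inj_onD)
  then show ?case using glued_sp.edge[of "f x" "f y"] by (simp add: image_mgraph_def)
next
  case (parallel G x y G')
  have inj: "inj_on f (verts G)" "inj_on f (verts G')"
    using parallel.prems by (auto intro: inj_on_subset)
  have "f ` verts G \<inter> f ` verts G' = {f x, f y}"
    using inj_on_image_Int[OF parallel.prems, of "verts G" "verts G'"] parallel.hyps(3) by simp
  then show ?case
    using parallel.IH inj unfolding image_mgraph_union by (intro glued_sp.parallel) auto
next
  case (series G x y G' z)
  have inj: "inj_on f (verts G)" "inj_on f (verts G')"
    using series.prems by (auto intro: inj_on_subset)
  have "f ` verts G \<inter> f ` verts G' = {f y}"
    using inj_on_image_Int[OF series.prems, of "verts G" "verts G'"] series.hyps(3) by simp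
  then show ?case
    using series.IH inj unfolding image_mgraph_union by (intro glued_sp.series[where y = "f y"]) auto
qed

text \<open>
  The identification map fixes the first graph and is injective on the second one: it is an
  isomorphism onto a copy of the second graph that meets the first one in the terminals.
\<close>

lemma two_terminal_sp_imp_glued_sp:
  assumes "two_terminal_sp G x y"
  shows "glued_sp G x y"
  using assms
proof induction
  case (K2 x y)
  then show ?case by (rule glued_sp.edge)
next
  case (parallel G x y G' x' y')
  note G = glued_sp_basic[OF parallel.IH(1)] and G' = glued_sp_basic[OF parallel.IH(2)]
  define f where "f = id(x' := x, y' := y)"
  have id_on: "f v = v" if "v \<in> verts G" for v
    using that G' parallel.hyps(3) by (auto simp: f_def)
  have fxy: "f x' = x" "f y' = y"
    using G' by (auto simp: f_def)
  have "inj_on f (verts G')"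
    using G G' parallel.hyps(3) by (auto simp: f_def inj_on_def)
  from glued_sp_image[OF parallel.IH(2) this]
  have "glued_sp (image_mgraph f G') x y" by (simp add: fxy)
  moreover have "verts G \<inter> f ` verts G' = {x, y}"
    using G G' parallel.hyps(3) fxy by (auto simp: f_def split: if_splits)
  ultimately have "glued_sp (union_mgraph G (image_mgraph f G')) x y"
    using parallel.IH(1) by (intro glued_sp.parallel) auto
  moreover have "image_mgraph f G = G"
    using id_on G by (intro image_mgraph_ident) auto
  ultimately show ?case
    by (simp add: image_mgraph_union f_def)
next
  case (series G x y G' x' y')
  note G = glued_sp_basic[OF series.IH(1)] and G' = glued_sp_basic[OF series.IH(2)]
  define f where "f = id(x' := y)"
  have id_on: "f v = v" if "v \<in> verts G" for v
    using that G' series.hyps(3) by (auto simp: f_def)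
  have fxy: "f x' = y" "f y' = y'"
    using G' by (auto simp: f_def)
  have "inj_on f (verts G')"
    using G G' series.hyps(3) by (auto simp: f_def inj_on_def)
  from glued_sp_image[OF series.IH(2) this]
  have "glued_sp (image_mgraph f G') y y'" by (simp add: fxy)
  moreover have "verts G \<inter> f ` verts G' = {y}"
    using G G' series.hyps(3) fxy by (auto simp: f_def split: if_splits)
  ultimately have "glued_sp (union_mgraph G (image_mgraph f G')) x y'"
    using series.IH(1) by (intro glued_sp.series[where y = y]) auto
  moreover have "image_mgraph f G = G"
    using id_on G by (intro image_mgraph_ident) auto
  ultimately show ?case
    by (simp add: image_mgraph_union f_def)
qed

text \<open>
  To undo an identification, the shared terminals get fresh names in the second part. The arbitrary
  injection \<open>f\<close> is what the induction needs, since it is these renamed copies that must again be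
  two-terminal series-parallel.
\<close>

lemma glued_sp_imp_two_terminal_sp_image:
  fixes f :: "'a \<Rightarrow> 'b"
  assumes "glued_sp G x y" "inj_on f (verts G)" "infinite (UNIV :: 'b set)"
  shows "two_terminal_sp (image_mgraph f G) (f x) (f y)"
  using assms(1,2)
proof (induction arbitrary: f)
  case (edge x y)
  then have "f x \<noteq> f y" by (auto dest: inj_onD)
  then show ?case using two_terminal_sp.K2[of "f x" "f y"] by (simp add: image_mgraph_def)
next
  case (parallel G x y G')
  note G = glued_sp_basic[OF parallel.hyps(1)] and G' = glued_sp_basic[OF parallel.hyps(2)]
  have inj: "inj_on f (verts G)" "inj_on f (verts G')"
    using parallel.prems by (auto intro: inj_on_subset)
  have "finite (f ` (verts G \<union> verts G'))" using G G' by blast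
  then obtain x' where x': "x' \<notin> f ` (verts G \<union> verts G')"
    using ex_new_if_finite[OF assms(3)] by blast
  have "finite (insert x' (f ` (verts G \<union> verts G')))" using G G' by blast
  then obtain y' where y': "y' \<notin> insert x' (f ` (verts G \<union> verts G'))"
    using ex_new_if_finite[OF assms(3)] by blast
  define g where "g = f(x := x', y := y')"
  have g_inj: "inj_on g (verts G')"
    using inj(2) x' y' G' unfolding g_def inj_on_def by auto
  have gxy: "g x = x'" "g y = y'" using G by (auto simp: g_def)
  have disj: "f ` verts G \<inter> g ` verts G' = {}"
  proof (rule ccontr)
    assume "f ` verts G \<inter> g ` verts G' \<noteq> {}"
    then obtain u v where uv: "u \<in> verts G" "v \<in> verts G'" "f u = g v" by blast
    then have "v \<noteq> x" "v \<noteq> y" using x' y' gxy by (metis UnCI image_eqI insertCI)+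
    then have "f u = f v" using uv by (simp add: g_def)
    then have "u = v" using parallel.prems uv by (auto dest: inj_onD)
    then show False using uv parallel.hyps(3) \<open>v \<noteq> x\<close> \<open>v \<noteq> y\<close> by blast
  qed
  let ?h = "id(x' := f x, y' := f y)"
  have "two_terminal_sp (image_mgraph ?h (union_mgraph (image_mgraph f G) (image_mgraph g G'))) (f x) (f y)"
    using two_terminal_sp.parallel[OF parallel.IH(1)[OF inj(1)] parallel.IH(2)[OF g_inj]] disj
    by (simp add: gxy)
  moreover have "image_mgraph (?h \<circ> f) G = image_mgraph f G"
    using x' y' G by (intro image_mgraph_cong) auto
  moreover have "image_mgraph (?h \<circ> g) G' = image_mgraph f G'"
  proof (rule image_mgraph_cong)
    fix v assume "v \<in> verts G'"
    then show "(?h \<circ> g) v = f v" using x' y' G by (auto simp: g_def)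
  qed (use G' in blast)
  ultimately show ?case by (simp add: image_mgraph_union image_mgraph_comp)
next
  case (series G x y G' z)
  note G = glued_sp_basic[OF series.hyps(1)] and G' = glued_sp_basic[OF series.hyps(2)]
  have inj: "inj_on f (verts G)" "inj_on f (verts G')"
    using series.prems by (auto intro: inj_on_subset)
  have "finite (f ` (verts G \<union> verts G'))" using G G' by blast
  then obtain y' where y': "y' \<notin> f ` (verts G \<union> verts G')"
    using ex_new_if_finite[OF assms(3)] by blast
  define g where "g = f(y := y')"
  have g_inj: "inj_on g (verts G')"
    using inj(2) y' G' unfolding g_def inj_on_def by auto
  have gyz: "g y = y'" "g z = f z" using G' by (auto simp: g_def)
  have disj: "f ` verts G \<inter> g ` verts G' = {}"
  proof (rule ccontr)
    assume "f ` verts G \<inter> g ` verts G' \<noteq> {}"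
    then obtain u v where uv: "u \<in> verts G" "v \<in> verts G'" "f u = g v" by blast
    then have "v \<noteq> y" using y' gyz by (metis UnCI image_eqI)
    then have "f u = f v" using uv by (simp add: g_def)
    then have "u = v" using series.prems uv by (auto dest: inj_onD)
    then show False using uv series.hyps(3) \<open>v \<noteq> y\<close> by blast
  qed
  let ?h = "id(y' := f y)"
  have "two_terminal_sp (image_mgraph ?h (union_mgraph (image_mgraph f G) (image_mgraph g G'))) (f x) (f z)"
    using two_terminal_sp.series[OF series.IH(1)[OF inj(1)] series.IH(2)[OF g_inj]] disj
    by (simp add: gyz)
  moreover have "image_mgraph (?h \<circ> f) G = image_mgraph f G"
    using y' G by (intro image_mgraph_cong) auto
  moreover have "image_mgraph (?h \<circ> g) G' = image_mgraph f G'"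
  proof (rule image_mgraph_cong)
    fix v assume "v \<in> verts G'"
    then show "(?h \<circ> g) v = f v" using y' G by (auto simp: g_def)
  qed (use G' in blast)
  ultimately show ?case by (simp add: image_mgraph_union image_mgraph_comp)
qed

lemma glued_sp_imp_series_parallel:
  assumes "glued_sp (G :: nat mgraph) x y"
  shows "series_parallel G"
  using glued_sp_imp_two_terminal_sp_image[OF assms, of id]
  by (auto simp: series_parallel_def)

section \<open>Paths and ears\<close>

fun path_edges :: "'a list \<Rightarrow> 'a set multiset" where
  "path_edges (u # v # p) = add_mset {u, v} (path_edges (v # p))"
| "path_edges _ = {#}"

definition path_graph :: "'a list \<Rightarrow> 'a mgraph" where
  "path_graph p = \<lparr>verts = set p, edges = path_edges p\<rparr>"

lemma path_graph_sel [simp]: "verts (path_graph p) = set p" "edges (path_graph p) = path_edges p"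
  by (simp_all add: path_graph_def)

lemma path_edges_append:
  "path_edges (p @ v # p') = path_edges (p @ [v]) + path_edges (v # p')"
  by (induction p rule: path_edges.induct) auto

lemma path_edges_rev: "path_edges (rev p) = path_edges p"
proof (induction p rule: path_edges.induct)
  case (1 u v p)
  then show ?case
    using path_edges_append[of "rev p" v "[u]"] by (simp add: insert_commute)
qed auto

lemma path_edges_conv_nth:
  "path_edges p = image_mset (\<lambda>i. {p ! i, p ! Suc i}) (mset [0..<length p - 1])"
proof (induction p rule: path_edges.induct)
  case (1 u v p)
  have "[0..<Suc (length p)] = 0 # map Suc [0..<length p]"
    by (simp only: map_Suc_upt upt_conv_Cons zero_less_Suc)
  then have "mset [0..<Suc (length p)] = add_mset 0 (image_mset Suc (mset [0..<length p]))"
    by (simp only: mset.simps mset_map)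
  with 1 show ?case by (simp add: multiset.map_comp comp_def del: upt_Suc)
qed auto

lemma cycle_edges_conv_path_edges:
  assumes "p \<noteq> []"
  shows "cycle_edges p = path_edges (p @ [hd p])"
proof -
  have "{p ! i, p ! (Suc i mod length p)} = {(p @ [hd p]) ! i, (p @ [hd p]) ! Suc i}"
    if "i < length p" for i
    using that assms by (cases "Suc i = length p") (auto simp: nth_append hd_conv_nth)
  then have "image_mset (\<lambda>i. {p ! i, p ! (Suc i mod length p)}) (mset [0..<length p]) =
      image_mset (\<lambda>i. {(p @ [hd p]) ! i, (p @ [hd p]) ! Suc i}) (mset [0..<length p])"
    by (intro image_mset_cong) simp
  then show ?thesis
    unfolding cycle_edges_def path_edges_conv_nth by simp
qed

text \<open>
  If both paths consist of the single edge between their ends, this is the cycle of length two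
  formed by two parallel edges.
\<close>

lemma is_cycle_union_paths:
  assumes "distinct p" "distinct p'" "length p \<ge> 2" "hd p' = hd p" "last p' = last p"
    and "set p \<inter> set p' = {hd p, last p}" "p' \<noteq> []"
    and "set p \<subseteq> verts G" "set p' \<subseteq> verts G" "path_edges p + path_edges p' \<subseteq># edges G"
  shows "\<exists>vs. is_cycle G vs \<and> length vs + 2 = length p + length p'"
proof -
  obtain u p1 where p1: "p = u # p1" "p1 \<noteq> []" using assms(3) by (cases p) (auto simp: Suc_le_eq)
  then obtain i v where p: "p = u # i @ [v]" by (cases p1 rule: rev_cases) auto
  then have "u \<noteq> v" using assms(1) by auto
  obtain p1' where p1': "p' = u # p1'" using assms(4,7) p by (cases p') auto
  then have "p1' \<noteq> []" using assms(5) p \<open>u \<noteq> v\<close> by auto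
  then have "p1' = butlast p1' @ [v]"
    using p1' assms(5) p append_butlast_last_id[of p1'] by simp
  then obtain i' where p': "p' = u # i' @ [v]"
    using p1' by blast
  let ?vs = "u # i @ v # rev i'"
  have "cycle_edges ?vs = path_edges (p @ rev i' @ [u])"
    using cycle_edges_conv_path_edges[of ?vs] p by simp
  also have "\<dots> = path_edges ((u # i) @ v # (rev i' @ [u]))" using p by simp
  also have "\<dots> = path_edges p + path_edges (v # rev i' @ [u])"
    using path_edges_append[of "u # i" v "rev i' @ [u]"] p by (simp only: append_Cons)
  also have "v # rev i' @ [u] = rev p'" using p' by simp
  finally have "cycle_edges ?vs = path_edges p + path_edges p'" by (simp only: path_edges_rev)
  moreover have "distinct ?vs" using assms(1,2,6) p p' by auto
  moreover have "set ?vs \<subseteq> verts G" using assms(8,9) p p' by auto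
  ultimately have "is_cycle G ?vs" using assms(10) by (simp add: is_cycle_def)
  moreover have "length ?vs + 2 = length p + length p'" using p p' by simp
  ultimately show ?thesis by blast
qed

definition spanning_path :: "'a mgraph \<Rightarrow> 'a list \<Rightarrow> 'a \<Rightarrow> 'a \<Rightarrow> bool" where
  "spanning_path G p x y \<longleftrightarrow>
     G = path_graph p \<and> distinct p \<and> length p \<ge> 2 \<and> hd p = x \<and> last p = y"

text \<open>
  An ear \<open>p\<close> attached to \<open>H\<close> is long if some path \<open>p'\<close> of \<open>H\<close> between the same ends is at most as
  long: the cycle that they form then gives a lower bound on \<open>p\<close> in terms of the girth.
\<close>

definition long_ear :: "'a mgraph \<Rightarrow> 'a list \<Rightarrow> bool" where
  "long_ear H p \<longleftrightarrow> distinct p \<and> length p \<ge> 2 \<and> set p \<inter> verts H = {hd p, last p} \<and>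
     (\<exists>p'. distinct p' \<and> p' \<noteq> [] \<and> hd p' = hd p \<and> last p' = last p \<and> length p' \<le> length p \<and>
       set p' \<subseteq> verts H \<and> path_edges p' \<subseteq># edges H)"

lemma long_ear_union:
  assumes "long_ear H p" "set p \<inter> verts G \<subseteq> verts H"
  shows "long_ear (union_mgraph H G) p"
proof -
  have "set p \<inter> verts (union_mgraph H G) = {hd p, last p}"
    using assms by (auto simp: long_ear_def)
  moreover obtain p' where p': "distinct p'" "p' \<noteq> []" "hd p' = hd p" "last p' = last p"
      "length p' \<le> length p" "set p' \<subseteq> verts H" "path_edges p' \<subseteq># edges H"
    using assms(1) by (auto simp: long_ear_def)
  moreover have "path_edges p' \<subseteq># edges (union_mgraph H G)" "set p' \<subseteq> verts (union_mgraph H G)"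
    using p'(6,7) by (auto intro: subset_mset.order_trans)
  ultimately show ?thesis
    using assms(1) unfolding long_ear_def by blast
qed

lemma long_ear_parallel_path:
  assumes "spanning_path G p x y" "spanning_path G' p' x y" "verts G \<inter> verts G' = {x, y}"
    and "length p' \<le> length p"
  shows "long_ear G' p"
  using assms unfolding spanning_path_def long_ear_def
  by (auto intro!: exI[of _ p'])

lemma spanning_path_series:
  assumes "spanning_path G p x y" "spanning_path G' p' y z" "verts G \<inter> verts G' = {y}"
  shows "spanning_path (union_mgraph G G') (p @ tl p') x z"
proof -
  obtain r where r: "p' = y # r" "r \<noteq> []"
    using assms(2) by (cases p') (auto simp: spanning_path_def Suc_le_eq)
  obtain s where s: "p = s @ [y]"
    using assms(1) unfolding spanning_path_def
    by (metis append_butlast_last_id list.size(3) not_numeral_le_zero)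
  have "path_edges (p @ tl p') = path_edges p + path_edges p'"
    using path_edges_append[of s y r] r s by simp
  moreover have "set p \<union> set p' = set (p @ tl p')" using r s by auto
  moreover have "distinct (p @ tl p')"
    using assms r s by (auto simp: spanning_path_def)
  moreover have "s \<noteq> []" using assms(1) s by (auto simp: spanning_path_def)
  ultimately show ?thesis
    using assms r s by (auto simp: spanning_path_def union_mgraph_def path_graph_def)
qed

text \<open>
  An ear of one component is an ear of the composition, and removing it leaves a composition of the
  same kind. The only other source of an ear is the parallel composition of two paths, where the
  longer path is an ear of the shorter one. The reduced graph keeps the terminals \<open>x\<close> and \<open>y\<close>; this
  is what lets the induction put it in place of the component.
\<close>

lemma glued_sp_path_or_long_ear:
  assumes "glued_sp G x y"
  shows "(\<exists>p. spanning_path G p x y) \<or>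
    (\<exists>H p. glued_sp H x y \<and> long_ear H p \<and> G = union_mgraph H (path_graph p))"
  using assms
proof induction
  case (edge x y)
  then have "spanning_path \<lparr>verts = {x, y}, edges = {#{x, y}#}\<rparr> [x, y] x y"
    by (simp add: spanning_path_def path_graph_def)
  then show ?case by blast
next
  case (parallel G x y G')
  \<comment> \<open>\<open>A\<close> is the component with the ear, on either side.\<close>
  have reduce: ?case
    if "glued_sp A x y" "glued_sp B x y" "verts A \<inter> verts B = {x, y}"
      "union_mgraph G G' = union_mgraph A B"
      "glued_sp H x y" "long_ear H p" "A = union_mgraph H (path_graph p)" for A B H p
  proof -
    note H = glued_sp_basic[OF that(5)]
    have "verts H \<inter> verts B = {x, y}" "set p \<inter> verts B \<subseteq> verts H"
      using that H glued_sp_basic[OF that(2)] by auto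
    then have "glued_sp (union_mgraph H B) x y" "long_ear (union_mgraph H B) p"
      using that by (auto intro: glued_sp.parallel long_ear_union)
    moreover have "union_mgraph G G' = union_mgraph (union_mgraph H B) (path_graph p)"
      using that by (simp add: union_mgraph_right_commute)
    ultimately show ?thesis by blast
  qed
  have int': "verts G' \<inter> verts G = {x, y}" using parallel.hyps(3) by blast
  consider (path) p p' where "spanning_path G p x y" "spanning_path G' p' x y"
    | (left) H p where "glued_sp H x y" "long_ear H p" "G = union_mgraph H (path_graph p)"
    | (right) H p where "glued_sp H x y" "long_ear H p" "G' = union_mgraph H (path_graph p)"
    using parallel.IH by blast
  then show ?case
  proof cases
    case path
    show ?thesis
    proof (cases "length p' \<le> length p")
      case True
      then have "long_ear G' p" using path parallel.hyps(3) by (intro long_ear_parallel_path)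
      moreover have "union_mgraph G G' = union_mgraph G' (path_graph p)"
        using path by (simp add: spanning_path_def union_mgraph_commute)
      ultimately show ?thesis using parallel.hyps(2) by blast
    next
      case False
      then have "long_ear G p'" using path int' by (intro long_ear_parallel_path[of G' p']) auto
      moreover have "union_mgraph G G' = union_mgraph G (path_graph p')"
        using path by (simp add: spanning_path_def)
      ultimately show ?thesis using parallel.hyps(1) by blast
    qed
  next
    case left
    with parallel.hyps show ?thesis by (intro reduce[of G G' H p]) auto
  next
    case right
    with parallel.hyps int' show ?thesis
      by (intro reduce[of G' G H p]) (auto simp: union_mgraph_commute)
  qed
next
  case (series G x y G' z)
  note G = glued_sp_basic[OF series.hyps(1)] and G' = glued_sp_basic[OF series.hyps(2)]
  consider (path) p p' where "spanning_path G p x y" "spanning_path G' p' y z"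
    | (left) H p where "glued_sp H x y" "long_ear H p" "G = union_mgraph H (path_graph p)"
    | (right) H p where "glued_sp H y z" "long_ear H p" "G' = union_mgraph H (path_graph p)"
    using series.IH by blast
  then show ?case
  proof cases
    case path
    show ?thesis using spanning_path_series[OF path series.hyps(3)] by (intro disjI1 exI)
  next
    case left
    note H = glued_sp_basic[OF left(1)]
    have "verts H \<inter> verts G' = {y}" "set p \<inter> verts G' \<subseteq> verts H"
      using left H G' series.hyps(3) by auto
    then have "glued_sp (union_mgraph H G') x z" "long_ear (union_mgraph H G') p"
      using left series.hyps(2) by (auto intro: glued_sp.series long_ear_union)
    moreover have "union_mgraph G G' = union_mgraph (union_mgraph H G') (path_graph p)"
      using left by (simp add: union_mgraph_right_commute)
    ultimately show ?thesis by blast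
  next
    case right
    note H = glued_sp_basic[OF right(1)]
    have "verts G \<inter> verts H = {y}" "set p \<inter> verts G \<subseteq> verts H"
      using right H G series.hyps(3) by auto
    then have "glued_sp (union_mgraph G H) x z" "long_ear (union_mgraph G H) p"
      using right series.hyps(1) glued_sp.series[of G x y H z] long_ear_union[of H p G]
      by (simp_all add: union_mgraph_commute[of H])
    moreover have "union_mgraph G G' = union_mgraph (union_mgraph G H) (path_graph p)"
      using right by (simp add: union_mgraph_def Un_assoc add.assoc)
    ultimately show ?thesis by blast
  qed
qed

lemma girth_le_cycle_length: "is_cycle G vs \<Longrightarrow> girth G \<le> enat (length vs)"
  unfolding girth_def by (auto intro: INF_lower)

lemma girth_antimono:
  assumes "verts H \<subseteq> verts G" "edges H \<subseteq># edges G"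
  shows "girth G \<le> girth H"
proof -
  have "{vs. is_cycle H vs} \<subseteq> {vs. is_cycle G vs}"
    using assms unfolding is_cycle_def by (blast intro: subset_mset.order_trans)
  then show ?thesis unfolding girth_def by (intro INF_superset_mono) auto
qed

text \<open>
  The ear and the path parallel to it form a cycle with at least \<open>4 * q - 1\<close> edges, and the longer
  of two integers with this sum is at least \<open>2 * q\<close>. The bound counts vertices, hence the \<open>+ 1\<close>.
\<close>

lemma long_ear_length:
  assumes "long_ear H p" "enat (4 * q - 1) \<le> girth (union_mgraph H (path_graph p))"
  shows "2 * q + 1 \<le> length p"
proof -
  let ?G = "union_mgraph H (path_graph p)"
  obtain p' where p': "distinct p'" "p' \<noteq> []" "hd p' = hd p" "last p' = last p"
      "length p' \<le> length p" "set p' \<subseteq> verts H" "path_edges p' \<subseteq># edges H"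
    and p: "distinct p" "length p \<ge> 2" "set p \<inter> verts H = {hd p, last p}"
    using assms(1) by (auto simp: long_ear_def)
  have "{hd p, last p} \<subseteq> set p'" using p'(2-4) by (metis empty_subsetI hd_in_set insert_subset last_in_set)
  then have "set p \<inter> set p' = {hd p, last p}" using p(3) p'(6) by blast
  moreover have "path_edges p + path_edges p' \<subseteq># edges ?G"
    using p'(7) by (simp add: add.commute)
  ultimately obtain vs where "is_cycle ?G vs" "length vs + 2 = length p + length p'"
    using is_cycle_union_paths[of p p' ?G] p p' by auto
  moreover from this have "4 * q - 1 \<le> length vs"
    using order_trans[OF assms(2) girth_le_cycle_length] by simp
  ultimately show ?thesis using p'(5) p(2) by linarith
qed

section \<open>Extending colourings along paths\<close>

lemma finite_subset_mostly_inside: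
  assumes "finite S" "D \<subseteq> S" "m \<le> card S" "m \<le> card D + t"
  shows "\<exists>C\<subseteq>S. card C = m \<and> card (C - D) \<le> t"
proof (cases "m \<le> card D")
  case True
  then obtain C where "C \<subseteq> D" "card C = m" by (meson obtain_subset_with_card_n)
  moreover from this have "card (C - D) = 0" by (simp add: Diff_eq_empty_iff[THEN iffD2])
  ultimately show ?thesis using assms(2) by (intro exI[of _ C]) auto
next
  case False
  then obtain C where C: "D \<subseteq> C" "C \<subseteq> S" "card C = m"
    using exists_subset_between[of D m S] assms by auto
  then have "card (C - D) = m - card D"
    using assms(1) finite_subset by (metis card_Diff_subset)
  then show ?thesis using C assms(4) by (intro exI[of _ C]) auto
qed

text \<open>
  One step backwards along a path: the next vertex has colours \<open>C'\<close>, and few of them lie in a set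
  \<open>Y\<close> that avoids \<open>W\<close>. Then most of \<open>Y\<close> is still available, and a choice made mainly from \<open>Y\<close>
  cannot contain much of \<open>W\<close>.
\<close>

lemma colour_before:
  assumes "finite L" "2 * m \<le> card L" "finite C'" "card C' = m"
    and "Y \<subseteq> L - W" "card (C' \<inter> Y) \<le> s" "m + s \<le> card Y + t"
  shows "\<exists>C\<subseteq>L. card C = m \<and> C \<inter> C' = {} \<and> card (C \<inter> W) \<le> t"
proof -
  have fY: "finite Y" using assms(1,5) finite_subset by blast
  have "card Y = card (Y - C') + card (C' \<inter> Y)"
    using card_Diff_subset_Int[of Y C'] fY card_mono[of Y "C' \<inter> Y"] by (simp add: Int_commute)
  then have "m \<le> card (Y - C') + t" using assms(6,7) by linarith
  moreover have "m \<le> card (L - C')"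
    using assms(2,4) diff_card_le_card_Diff[OF assms(3), of L] by linarith
  moreover have "Y - C' \<subseteq> L - C'" using assms(5) by blast
  ultimately obtain C where C: "C \<subseteq> L - C'" "card C = m" "card (C - (Y - C')) \<le> t"
    using finite_subset_mostly_inside[of "L - C'" "Y - C'" m t] assms(1) by blast
  have "finite C" using C(1) assms(1) by (meson finite_Diff finite_subset)
  then have "card (C \<inter> W) \<le> card (C - (Y - C'))"
    using assms(5) by (intro card_mono) auto
  then show ?thesis using C by (intro exI[of _ C]) auto
qed

definition proper_along :: "('a \<Rightarrow> 'c set) \<Rightarrow> 'a list \<Rightarrow> bool" where
  "proper_along \<psi> p \<longleftrightarrow> successively (\<lambda>u v. \<psi> u \<inter> \<psi> v = {}) p"

definition list_coloured :: "nat \<Rightarrow> ('a \<Rightarrow> 'c set) \<Rightarrow> ('a \<Rightarrow> 'c set) \<Rightarrow> 'a set \<Rightarrow> bool" where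
  "list_coloured m L \<psi> V \<longleftrightarrow> (\<forall>v\<in>V. \<psi> v \<subseteq> L v \<and> finite (\<psi> v) \<and> card (\<psi> v) = m)"

lemma proper_along_cong:
  assumes "\<And>v. v \<in> set p \<Longrightarrow> \<psi> v = \<psi>' v"
  shows "proper_along \<psi> p \<longleftrightarrow> proper_along \<psi>' p"
  unfolding proper_along_def using assms by (intro successively_cong) auto

lemma proper_along_Cons:
  "p \<noteq> [] \<Longrightarrow> proper_along \<psi> (v # p) \<longleftrightarrow> \<psi> v \<inter> \<psi> (hd p) = {} \<and> proper_along \<psi> p"
  by (cases p) (auto simp: proper_along_def)

lemma proper_along_edge:
  assumes "proper_along \<psi> p" "{u, v} \<in># path_edges p"
  shows "\<psi> u \<inter> \<psi> v = {}"
  using assms by (induction p rule: path_edges.induct) (auto simp: proper_along_def doubleton_eq_iff)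

text \<open>
  The bound \<open>t\<close> on the use of \<open>W\<close> at the first vertex \<open>u\<close> becomes a bound \<open>t + e\<close> on the use of
  some set \<open>Z\<close> of the same size \<open>m\<close> at the third vertex. Namely, choose \<open>Y\<close> of size \<open>m + e\<close> in
  the list of \<open>u\<close> outside \<open>W\<close>, and \<open>Z\<close> of size \<open>m\<close> in the list of the second vertex outside
  \<open>Y\<close>. If the third vertex uses at most \<open>t + e\<close> colours of \<open>Z\<close>, the second one can be coloured with
  at most \<open>t + e\<close> colours of \<open>Y\<close>, and since \<open>Y\<close> has \<open>e\<close> spare colours, \<open>u\<close> with at most \<open>t\<close>
  colours of \<open>W\<close>. Once the bound has reached \<open>m\<close> it no longer restricts the prescribed set \<open>B\<close> at
  the other end.
\<close>

lemma path_extension_constrained: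
  fixes L :: "'a \<Rightarrow> 'c set"
  assumes "length p = 2 * Suc s" "distinct p" "m \<le> t + Suc s * e"
    and "finite W" "card W = m" "finite B" "card B = m"
    and "\<forall>v\<in>set (butlast p). finite (L v) \<and> 2 * m + e \<le> card (L v)"
  shows "\<exists>\<psi>. \<psi> (last p) = B \<and> list_coloured m L \<psi> (set (butlast p)) \<and> proper_along \<psi> p \<and>
    card (\<psi> (hd p) \<inter> W) \<le> t"
  using assms
proof (induction s arbitrary: p t W)
  case 0
  obtain u v where p: "p = [u, v]"
    using 0(1) by (cases p; cases "tl p") auto
  have L: "finite (L u)" "2 * m + e \<le> card (L u)" using 0 p by auto
  have "card (L u) - m \<le> card (L u - W)"
    using diff_card_le_card_Diff[OF 0(4), of "L u"] 0(5) by simp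
  moreover have "card (B \<inter> (L u - W)) \<le> m" using card_mono[of B] 0(6,7) by auto
  ultimately have "\<exists>C\<subseteq>L u. card C = m \<and> C \<inter> B = {} \<and> card (C \<inter> W) \<le> t"
    using L 0 by (intro colour_before[where Y = "L u - W" and s = m]) auto
  then obtain C where C: "C \<subseteq> L u" "card C = m" "C \<inter> B = {}" "card (C \<inter> W) \<le> t" by blast
  have "finite C" using C(1) L finite_subset by blast
  then show ?case
    using 0 p C
    by (intro exI[of _ "\<lambda>w. if w = u then C else B"]) (auto simp: list_coloured_def proper_along_def)
next
  case (Suc s)
  obtain u v r where p: "p = u # v # r" and len: "length r = 2 * Suc s"
    using Suc.prems(1) by (cases p; cases "tl p") auto
  then have r: "r \<noteq> []" by auto
  have Lu: "finite (L u)" "2 * m + e \<le> card (L u)" and Lv: "finite (L v)" "2 * m + e \<le> card (L v)"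
    using Suc.prems(8) p r by auto
  have "m + e \<le> card (L u - W)"
    using diff_card_le_card_Diff[of W "L u"] Suc.prems(4,5) Lu by linarith
  then obtain Y where Y: "Y \<subseteq> L u - W" "card Y = m + e" by (meson obtain_subset_with_card_n)
  then have fY: "finite Y" using Lu by (meson finite_Diff finite_subset)
  have "m \<le> card (L v - Y)"
    using diff_card_le_card_Diff[OF fY, of "L v"] Y Lv by linarith
  then obtain Z where Z: "Z \<subseteq> L v - Y" "card Z = m" by (meson obtain_subset_with_card_n)
  then have fZ: "finite Z" using Lv by (meson finite_Diff finite_subset)
  have "\<exists>\<psi>. \<psi> (last r) = B \<and> list_coloured m L \<psi> (set (butlast r)) \<and> proper_along \<psi> r \<and>
      card (\<psi> (hd r) \<inter> Z) \<le> t + e"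
    using Suc.prems p r fZ Z len by (intro Suc.IH) auto
  then obtain \<psi> where \<psi>: "\<psi> (last r) = B" "list_coloured m L \<psi> (set (butlast r))"
      "proper_along \<psi> r" "card (\<psi> (hd r) \<inter> Z) \<le> t + e" by blast
  have "hd r \<in> set (butlast r)" using len by (cases r; cases "tl r") auto
  then have hd: "finite (\<psi> (hd r))" "card (\<psi> (hd r)) = m"
    using \<psi>(2) by (auto simp: list_coloured_def)
  have "\<exists>C\<subseteq>L v. card C = m \<and> C \<inter> \<psi> (hd r) = {} \<and> card (C \<inter> Y) \<le> t + e"
    using Lv hd Z \<psi>(4) by (intro colour_before[where Y = Z and s = "t + e"]) auto
  then obtain C where C: "C \<subseteq> L v" "card C = m" "C \<inter> \<psi> (hd r) = {}" "card (C \<inter> Y) \<le> t + e"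
    by blast
  have fC: "finite C" using C(1) Lv finite_subset by blast
  have "\<exists>D\<subseteq>L u. card D = m \<and> D \<inter> C = {} \<and> card (D \<inter> W) \<le> t"
    using Lu fC C Y by (intro colour_before[where Y = Y and s = "t + e"]) auto
  then obtain D where D: "D \<subseteq> L u" "card D = m" "D \<inter> C = {}" "card (D \<inter> W) \<le> t" by blast
  have fD: "finite D" using D(1) Lu finite_subset by blast
  define \<chi> where "\<chi> = \<psi>(v := C, u := D)"
  have dist: "u \<notin> set r" "v \<notin> set r" "u \<noteq> v" using Suc.prems(2) p by auto
  then have eq: "\<chi> w = \<psi> w" if "w \<in> set r" for w using that by (auto simp: \<chi>_def)
  have "proper_along \<chi> r" using \<psi>(3) eq proper_along_cong by metis
  moreover have "\<chi> (hd r) = \<psi> (hd r)" "\<chi> (last r) = \<psi> (last r)" using eq r by auto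
  moreover have "\<chi> u = D" "\<chi> v = C" using dist by (auto simp: \<chi>_def)
  moreover have "list_coloured m L \<chi> (set (butlast r))"
    using \<psi>(2) eq in_set_butlastD unfolding list_coloured_def by metis
  ultimately show ?case
    using p r C D \<psi>(1) fC fD by (intro exI[of _ \<chi>]) (auto simp: proper_along_Cons list_coloured_def)
qed

text \<open>
  For an even number of edges this is the constrained extension on the path without its first
  vertex, where \<open>W\<close> is the set of the first vertex and \<open>t = 0\<close>. Otherwise the second vertex is
  coloured greedily; an odd length is at least \<open>2 * q + 1\<close>, so \<open>2 * q\<close> edges remain.
\<close>

lemma path_extension:
  fixes L :: "'a \<Rightarrow> 'c set"
  assumes "0 < q" "m \<le> q * e" "2 * q + 1 \<le> length p" "distinct p"
    and "finite A" "card A = m" "finite B" "card B = m"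
    and lists: "\<forall>v\<in>set (butlast (tl p)). finite (L v) \<and> 2 * m + e \<le> card (L v)"
  shows "\<exists>\<psi>. \<psi> (hd p) = A \<and> \<psi> (last p) = B \<and> list_coloured m L \<psi> (set (butlast (tl p))) \<and>
    proper_along \<psi> p"
proof -
  have even_case: "\<exists>\<psi>. \<psi> u = A \<and> \<psi> (last r) = B \<and> list_coloured m L \<psi> (set (butlast r)) \<and>
      proper_along \<psi> (u # r)"
    if "even (length r)" "2 * q \<le> length r" "distinct (u # r)" "finite A" "card A = m"
      "\<forall>v\<in>set (butlast r). finite (L v) \<and> 2 * m + e \<le> card (L v)" for u r A
  proof -
    note r_prems = that
    have "length r = 2 * Suc (length r div 2 - 1)"
      using that(1,2) assms(1) by (auto elim!: evenE)
    then obtain s where s: "length r = 2 * Suc s" by blast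
    then have "q \<le> Suc s" using that(2) by simp
    then have m: "m \<le> 0 + Suc s * e" using assms(2) by (metis add_0 le_trans mult_le_mono1)
    obtain \<psi> where \<psi>: "\<psi> (last r) = B" "list_coloured m L \<psi> (set (butlast r))"
        "proper_along \<psi> r" "card (\<psi> (hd r) \<inter> A) \<le> 0"
      using path_extension_constrained[OF s _ m r_prems(4,5) assms(7,8) r_prems(6)] r_prems(3) by auto
    have r: "r \<noteq> []" using s by auto
    have "\<psi> (hd r) \<inter> A = {}" using \<psi>(4) that(4) by simp
    moreover have "proper_along (\<psi>(u := A)) r"
      using \<psi>(3) that(3) by (subst proper_along_cong[of r _ \<psi>]) auto
    moreover have "list_coloured m L (\<psi>(u := A)) (set (butlast r))"
      using \<psi>(2) that(3) by (auto simp: list_coloured_def dest: in_set_butlastD)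
    ultimately show ?thesis
      using \<psi>(1) that(3) r hd_in_set[OF r] last_in_set[OF r]
      by (intro exI[of _ "\<psi>(u := A)"]) (auto simp: proper_along_Cons)
  qed
  obtain u r where p: "p = u # r" using assms(3) by (cases p) auto
  show ?thesis
  proof (cases "even (length r)")
    case True
    have "r \<noteq> []" using assms(1,3) p by auto
    with even_case[OF True, of u A] assms p show ?thesis by auto
  next
    case False
    then obtain v r' where r: "r = v # r'" by (cases r) auto
    have r': "even (length r')" "2 * q \<le> length r'" "r' \<noteq> []"
      using False assms(1,3) p r by (auto elim!: oddE evenE)
    have Lv: "finite (L v)" "2 * m + e \<le> card (L v)" using lists p r r' by auto
    have "m \<le> card (L v - A)" using diff_card_le_card_Diff[OF assms(5), of "L v"] Lv assms(6) by linarith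
    then obtain C where C: "C \<subseteq> L v - A" "card C = m" by (meson obtain_subset_with_card_n)
    have fC: "finite C" using C(1) Lv by (meson finite_Diff finite_subset)
    obtain \<psi> where \<psi>: "\<psi> v = C" "\<psi> (last r') = B" "list_coloured m L \<psi> (set (butlast r'))"
        "proper_along \<psi> (v # r')"
      using even_case[of r' v C] r' fC C(2) assms(4) lists p r by auto
    have "proper_along (\<psi>(u := A)) (v # r')"
      using \<psi>(4) assms(4) p r by (subst proper_along_cong[of _ _ \<psi>]) auto
    moreover have "list_coloured m L (\<psi>(u := A)) (set (butlast r'))"
      using \<psi>(3) assms(4) p r by (auto simp: list_coloured_def dest: in_set_butlastD)
    moreover have "u \<noteq> v" "u \<noteq> last r'" using assms(4) p r last_in_set[OF r'(3)] by auto
    ultimately show ?thesis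
      using \<psi>(1,2) C fC p r r'(3)
      by (intro exI[of _ "\<psi>(u := A)"]) (auto simp: proper_along_Cons list_coloured_def)
  qed
qed

lemma path_list_colouring:
  fixes L :: "'a \<Rightarrow> 'c set"
  assumes "p \<noteq> []" "distinct p" "\<forall>v\<in>set p. finite (L v) \<and> 2 * m \<le> card (L v)"
  shows "\<exists>\<psi>. list_coloured m L \<psi> (set p) \<and> proper_along \<psi> p"
  using assms
proof (induction p rule: list_nonempty_induct)
  case (single v)
  then obtain C where "C \<subseteq> L v" "card C = m" "finite C"
    by (metis finite_subset list.set_intros(1) mult_2 obtain_subset_with_card_n trans_le_add1 le_trans le_add1)
  then show ?case
    by (intro exI[of _ "\<lambda>_. C"]) (auto simp: list_coloured_def proper_along_def)
next
  case (cons v p)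
  then obtain \<psi> where \<psi>: "list_coloured m L \<psi> (set p)" "proper_along \<psi> p" by auto
  have hd: "finite (\<psi> (hd p))" "card (\<psi> (hd p)) = m"
    using \<psi>(1) cons.hyps by (auto simp: list_coloured_def)
  then have "m \<le> card (L v - \<psi> (hd p))"
    using diff_card_le_card_Diff[OF hd(1), of "L v"] cons.prems by auto
  then obtain C where C: "C \<subseteq> L v - \<psi> (hd p)" "card C = m" by (meson obtain_subset_with_card_n)
  then have fC: "finite C" using cons.prems by (meson finite_Diff finite_subset list.set_intros(1))
  have "proper_along (\<psi>(v := C)) p"
    using \<psi>(2) cons.prems by (subst proper_along_cong[of _ _ \<psi>]) auto
  moreover have "hd p \<noteq> v" using cons.prems(1) cons.hyps by (metis distinct.simps(2) hd_in_set)
  moreover have "list_coloured m L (\<psi>(v := C)) (set p)"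
    using \<psi>(1) cons.prems(1) by (auto simp: list_coloured_def)
  ultimately show ?case
    using C fC cons.hyps
    by (intro exI[of _ "\<psi>(v := C)"])
      (auto simp: proper_along_Cons list_coloured_def simp del: fun_upd_apply simp add: fun_upd_same fun_upd_other)
qed

section \<open>The upper bound\<close>

lemma fold_list_colouring_alt:
  "fold_list_colouring G m L \<phi> \<longleftrightarrow> list_coloured m L \<phi> (verts G) \<and>
    (\<forall>u\<in>verts G. \<forall>v\<in>verts G. {u, v} \<in># edges G \<longrightarrow> \<phi> u \<inter> \<phi> v = {})"
  by (auto simp: fold_list_colouring_def fold_colouring_def list_coloured_def adjacent_def)

lemma fold_list_colouring_add_ear:
  assumes "long_ear H p" "fold_list_colouring H m L \<phi>" "\<forall>e \<in># edges H. e \<subseteq> verts H"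
    and "0 < q" "m \<le> q * e" "2 * q + 1 \<le> length p"
    and "\<forall>v\<in>set p. finite (L v) \<and> 2 * m + e \<le> card (L v)"
  shows "\<exists>\<phi>. fold_list_colouring (union_mgraph H (path_graph p)) m L \<phi>"
proof -
  note \<phi> = assms(2)[unfolded fold_list_colouring_alt list_coloured_def]
  have p: "distinct p" "set p \<inter> verts H = {hd p, last p}"
    using assms(1) by (auto simp: long_ear_def)
  obtain u r where ur: "p = u # r" "r \<noteq> []" using assms(4,6) by (cases p; cases "tl p") auto
  have ends: "hd p \<in> verts H" "last p \<in> verts H" using p by auto
  have "\<exists>\<psi>. \<psi> (hd p) = \<phi> (hd p) \<and> \<psi> (last p) = \<phi> (last p) \<and>
      list_coloured m L \<psi> (set (butlast (tl p))) \<and> proper_along \<psi> p"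
    using assms p(1) ends \<phi> in_set_butlastD[of _ "tl p"] ur by (intro path_extension[of q m e]) auto
  then obtain \<psi> where \<psi>: "\<psi> (hd p) = \<phi> (hd p)" "\<psi> (last p) = \<phi> (last p)"
      "list_coloured m L \<psi> (set (butlast (tl p)))" "proper_along \<psi> p" by blast
  define \<chi> where "\<chi> v = (if v \<in> verts H then \<phi> v else \<psi> v)" for v
  have \<chi>: "\<chi> v = \<psi> v" if "v \<in> set p" for v
  proof (cases "v \<in> verts H")
    case True
    then have "v \<in> {hd p, last p}" using that p(2) by blast
    then show ?thesis using \<psi>(1,2) True by (auto simp: \<chi>_def)
  qed (simp add: \<chi>_def)
  have "set p = {hd p, last p} \<union> set (butlast (tl p))"
    using ur append_butlast_last_id[of r] by (metis (no_types, lifting) Un_commute insert_is_Un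
        last_ConsR list.sel(1,3) list.simps(15) set_append empty_set Un_assoc)
  then have "list_coloured m L \<chi> (verts H \<union> set p)"
    using \<phi> \<psi>(3) ends unfolding list_coloured_def \<chi>_def by auto
  moreover have "proper_along \<chi> p" using \<psi>(4) \<chi> proper_along_cong by metis
  then have "\<chi> v \<inter> \<chi> w = {}" if "{v, w} \<in># path_edges p" for v w
    using proper_along_edge that by metis
  moreover have "\<chi> v \<inter> \<chi> w = {}" if "{v, w} \<in># edges H" for v w
    using that \<phi> assms(3) by (auto simp: \<chi>_def)
  ultimately have "fold_list_colouring (union_mgraph H (path_graph p)) m L \<chi>"
    unfolding fold_list_colouring_alt by simp
  then show ?thesis by blast
qed

lemma glued_sp_fold_list_colouring:
  assumes "glued_sp G x y" "enat (4 * q - 1) \<le> girth G" "0 < q" "m \<le> q * e"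
    and "\<forall>v\<in>verts G. finite (L v) \<and> 2 * m + e \<le> card (L v)"
  shows "\<exists>\<phi>. fold_list_colouring G m L \<phi>"
  using assms
proof (induction "size (edges G)" arbitrary: G rule: less_induct)
  case less
  consider (path) p where "spanning_path G p x y"
    | (ear) H p where "glued_sp H x y" "long_ear H p" "G = union_mgraph H (path_graph p)"
    using glued_sp_path_or_long_ear[OF less.prems(1)] by blast
  then show ?case
  proof cases
    case path
    then have "\<exists>\<psi>. list_coloured m L \<psi> (set p) \<and> proper_along \<psi> p"
      using less.prems(5) by (intro path_list_colouring) (auto simp: spanning_path_def)
    then obtain \<psi> where "list_coloured m L \<psi> (set p)" "proper_along \<psi> p" by blast
    then have "fold_list_colouring G m L \<psi>"
      using path proper_along_edge[of \<psi> p]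
      by (auto simp: spanning_path_def fold_list_colouring_alt)
    then show ?thesis by blast
  next
    case ear
    have len: "2 * q + 1 \<le> length p" using long_ear_length ear less.prems(2) by blast
    then have "path_edges p \<noteq> {#}" using less.prems(3) by (cases p rule: path_edges.cases) auto
    then have "size (edges H) < size (edges G)" using ear by (simp add: nonempty_has_size)
    moreover have "enat (4 * q - 1) \<le> girth H"
      using less.prems(2) girth_antimono[of H G] ear by (auto intro: order_trans)
    ultimately obtain \<phi> where "fold_list_colouring H m L \<phi>"
      using less.hyps[of H] ear less.prems by auto
    then show ?thesis
      using fold_list_colouring_add_ear[of H p m L \<phi> q e] ear len less.prems glued_sp_basic(5)[OF ear(1)]
      by auto
  qed
qed

lemma series_parallel_choosable:
  assumes "series_parallel G" "enat (4 * q - 1) \<le> girth G" "0 < q" "m \<le> q * e"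
  shows "choosable G (2 * m + e) m"
proof -
  obtain x y where "two_terminal_sp G x y"
    using assms(1) by (auto simp: series_parallel_def)
  then have "glued_sp G x y" by (rule two_terminal_sp_imp_glued_sp)
  then show ?thesis
    using glued_sp_fold_list_colouring assms by (fastforce simp: choosable_def list_assignment_def)
qed

lemma strongly_fractional_choosable_upper:
  assumes "series_parallel G" "enat (4 * q - 1) \<le> girth G" "0 < q"
  shows "strongly_fractional_choosable G (2 + 1 / real q)"
  unfolding strongly_fractional_choosable_def
proof (intro allI impI)
  fix m :: nat
  define e where "e = nat \<lceil>real m / real q\<rceil>"
  have "(2 + 1 / real q) * real m = of_int (int (2 * m)) + real m / real q"
    by (simp add: field_simps)
  then have "\<lceil>(2 + 1 / real q) * real m\<rceil> = int (2 * m) + \<lceil>real m / real q\<rceil>"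
    by (metis ceiling_add_of_int add.commute)
  moreover have "0 \<le> \<lceil>real m / real q\<rceil>" by (simp add: zero_le_ceiling less_le_trans[of "-1" 0])
  ultimately have a: "nat \<lceil>(2 + 1 / real q) * real m\<rceil> = 2 * m + e"
    by (simp add: e_def nat_add_distrib)
  have "real m / real q \<le> real e" unfolding e_def by (rule of_nat_ceiling)
  then have "real m \<le> real (q * e)" using assms(3) by (simp add: field_simps)
  then have "m \<le> q * e" by (simp only: of_nat_le_iff)
  then show "choosable G (nat \<lceil>(2 + 1 / real q) * real m\<rceil>) m"
    unfolding a using assms by (intro series_parallel_choosable)
qed

section \<open>Generalised theta graphs\<close>

text \<open>
  The vertex number \<open>i\<close> on thread \<open>j\<close>, where each thread has \<open>n\<close> edges; all threads run from the
  common vertex \<open>0\<close> to the common vertex \<open>1\<close>.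
\<close>

definition node :: "nat \<Rightarrow> nat \<Rightarrow> nat \<Rightarrow> nat" where
  "node n j i = (if i = 0 then 0 else if n \<le> i then 1 else 2 + prod_encode (j, i))"

definition theta_graph :: "nat \<Rightarrow> nat \<Rightarrow> nat mgraph" where
  "theta_graph n N =
    \<lparr>verts = (\<lambda>(j, i). node n j i) ` ({..<N} \<times> {..n}),
     edges = image_mset (\<lambda>(j, i). {node n j i, node n j (Suc i)}) (mset_set ({..<N} \<times> {..<n}))\<rparr>"

lemma node_eq_iff:
  assumes "i \<le> n" "i' \<le> n" "0 < n"
  shows "node n j i = node n j' i' \<longleftrightarrow> i = i' \<and> (j = j' \<or> i = 0 \<or> i = n)"
  using assms by (auto simp: node_def)

lemma node_0 [simp]: "node n j 0 = 0" and node_end [simp]: "0 < n \<Longrightarrow> node n j n = 1"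
  by (simp_all add: node_def)

lemma glued_sp_path_graph:
  assumes "distinct p" "length p \<ge> 2"
  shows "glued_sp (path_graph p) (hd p) (last p)"
  using assms
proof (induction p rule: path_edges.induct)
  case (1 u v r)
  have uv: "glued_sp (path_graph [u, v]) u v"
    using 1(2) glued_sp.edge[of u v] by (simp add: path_graph_def)
  show ?case
  proof (cases r)
    case Nil
    then show ?thesis using uv by simp
  next
    case (Cons w r')
    have "glued_sp (path_graph (v # r)) v (last (v # r))"
      using 1 Cons by simp
    moreover have "verts (path_graph [u, v]) \<inter> verts (path_graph (v # r)) = {v}"
      using 1(2) by auto
    ultimately have "glued_sp (union_mgraph (path_graph [u, v]) (path_graph (v # r))) u (last (v # r))"
      using uv by (intro glued_sp.series[where y = v])
    moreover have "union_mgraph (path_graph [u, v]) (path_graph (v # r)) = path_graph (u # v # r)"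
      by (auto simp: union_mgraph_def path_graph_def)
    ultimately show ?thesis by simp
  qed
qed auto

definition thread :: "nat \<Rightarrow> nat \<Rightarrow> nat list" where
  "thread n j = map (node n j) [0..<Suc n]"

lemma glued_sp_thread:
  assumes "0 < n"
  shows "glued_sp (path_graph (thread n j)) 0 1"
proof -
  have "distinct (thread n j)"
    using assms by (auto simp: thread_def distinct_map inj_on_def node_eq_iff simp del: upt_Suc)
  moreover have "hd (thread n j) = 0" "last (thread n j) = 1" "length (thread n j) \<ge> 2"
    using assms by (auto simp: thread_def hd_map last_map simp del: upt_Suc)
  ultimately show ?thesis using glued_sp_path_graph by metis
qed

lemma path_graph_thread:
  "path_graph (thread n j) =
    \<lparr>verts = node n j ` {..n}, edges = image_mset (\<lambda>i. {node n j i, node n j (Suc i)}) (mset_set {..<n})\<rparr>"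
proof -
  have "path_edges (thread n j) = image_mset (\<lambda>i. {node n j i, node n j (Suc i)}) (mset [0..<n])"
    unfolding path_edges_conv_nth thread_def
    by (simp only: length_map length_upt) (auto intro!: image_mset_cong simp: nth_append simp del: upt_Suc)
  moreover have "mset [0..<n] = mset_set {..<n}" by (simp add: atLeast0LessThan)
  moreover have "set (thread n j) = node n j ` {..n}"
    unfolding thread_def by (simp only: set_map set_upt atLeast0LessThan lessThan_Suc_atMost)
  ultimately show ?thesis by (simp only: path_graph_def)
qed

lemma theta_graph_Suc:
  "theta_graph n (Suc N) = union_mgraph (theta_graph n N) (path_graph (thread n N))"
proof -
  have "{..<Suc N} \<times> {..<n} = ({..<N} \<times> {..<n}) \<union> Pair N ` {..<n}" by auto
  then have "mset_set ({..<Suc N} \<times> {..<n}) = mset_set ({..<N} \<times> {..<n}) + mset_set (Pair N ` {..<n})"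
    by (simp only:) (rule mset_set_Union, auto)
  also have "mset_set (Pair N ` {..<n}) = image_mset (Pair N) (mset_set {..<n})"
    by (simp add: image_mset_mset_set inj_on_def)
  finally have "edges (theta_graph n (Suc N)) = edges (union_mgraph (theta_graph n N) (path_graph (thread n N)))"
    by (simp add: theta_graph_def path_graph_thread multiset.map_comp comp_def)
  moreover have "verts (theta_graph n (Suc N)) = verts (union_mgraph (theta_graph n N) (path_graph (thread n N)))"
    unfolding theta_graph_def union_mgraph_def path_graph_thread by (auto simp: lessThan_Suc)
  ultimately show ?thesis by simp
qed

lemma glued_sp_theta_graph:
  assumes "0 < n"
  shows "glued_sp (theta_graph n (Suc N)) 0 1"
proof (induction N)
  case 0
  have "theta_graph n (Suc 0) = path_graph (thread n 0)"
    unfolding theta_graph_Suc by (simp add: union_mgraph_def theta_graph_def path_graph_def)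
  then show ?case using glued_sp_thread[OF assms] by simp
next
  case (Suc N)
  have "verts (theta_graph n (Suc N)) \<inter> verts (path_graph (thread n (Suc N))) = {0, 1}"
  proof
    show "verts (theta_graph n (Suc N)) \<inter> verts (path_graph (thread n (Suc N))) \<subseteq> {0, 1}"
      using assms by (auto simp: theta_graph_def path_graph_thread node_eq_iff)
    show "{0, 1} \<subseteq> verts (theta_graph n (Suc N)) \<inter> verts (path_graph (thread n (Suc N)))"
      using glued_sp_basic[OF Suc] glued_sp_basic[OF glued_sp_thread[OF assms]] by blast
  qed
  then show ?case
    using Suc glued_sp_thread[OF assms] unfolding theta_graph_Suc[of n "Suc N"]
    by (intro glued_sp.parallel)
qed

lemma theta_graph_edges_set:
  assumes "2 \<le> n"
  shows "edges (theta_graph n N) =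
    mset_set ((\<lambda>(j, i). {node n j i, node n j (Suc i)}) ` ({..<N} \<times> {..<n}))"
proof -
  have "inj_on (\<lambda>(j, i). {node n j i, node n j (Suc i)}) ({..<N} \<times> {..<n})"
    using assms by (auto simp: inj_on_def doubleton_eq_iff node_eq_iff)
  then show ?thesis by (simp add: theta_graph_def image_mset_mset_set)
qed

lemma adjacent_theta_graph_iff:
  "adjacent (theta_graph n N) u v \<longleftrightarrow>
    (\<exists>j<N. \<exists>i<n. u = node n j i \<and> v = node n j (Suc i) \<or> v = node n j i \<and> u = node n j (Suc i))"
proof -
  have "adjacent (theta_graph n N) u v \<longleftrightarrow> (\<exists>j<N. \<exists>i<n. {u, v} = {node n j i, node n j (Suc i)})"
    by (auto simp: adjacent_def theta_graph_def)
  then show ?thesis by (auto simp: doubleton_eq_iff)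
qed

text \<open>
  The two vertices next to \<open>v\<close> on the cycle can coincide only if the cycle has length at most two,
  and such a cycle requires a loop or a pair of parallel edges.
\<close>

lemma cycle_two_neighbours:
  assumes "is_cycle G vs" "\<And>e. e \<in># edges G \<Longrightarrow> card e = 2" "\<And>e. count (edges G) e \<le> 1"
    and "v \<in> set vs"
  shows "\<exists>u\<in>set vs. \<exists>w\<in>set vs. u \<noteq> w \<and> adjacent G v u \<and> adjacent G v w"
proof -
  let ?l = "length vs"
  have cyc: "distinct vs" "cycle_edges vs \<subseteq># edges G" using assms(1) by (auto simp: is_cycle_def)
  have edge: "{vs ! i, vs ! (Suc i mod ?l)} \<in># edges G" if "i < ?l" for i
    using that by (intro mset_subset_eqD[OF cyc(2)]) (auto simp: cycle_edges_def)
  obtain i where i: "i < ?l" "v = vs ! i" using assms(4) by (auto simp: in_set_conv_nth)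
  have "?l \<noteq> 1"
    using edge[of 0] assms(2)[of "{vs ! 0}"] by (cases vs) auto
  moreover have "?l \<noteq> 2"
  proof
    assume "?l = 2"
    then obtain a b where ab: "vs = [a, b]" by (cases vs; cases "tl vs") auto
    then have "cycle_edges vs = {# {a, b}, {a, b} #}"
      by (simp add: cycle_edges_conv_path_edges insert_commute)
    then have "2 \<le> count (edges G) {a, b}"
      using mset_subset_eq_count[OF cyc(2), of "{a, b}"] by simp
    then show False using assms(3)[of "{a, b}"] by simp
  qed
  ultimately have l: "3 \<le> ?l" using i(1) by linarith
  define s where "s = Suc i mod ?l"
  define t where "t = (if i = 0 then ?l - 1 else i - 1)"
  have st: "s < ?l" "t < ?l" "Suc t mod ?l = i" "s \<noteq> t"
    using l i(1) unfolding s_def t_def by (auto simp: mod_Suc)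
  have "adjacent G v (vs ! s)" "adjacent G v (vs ! t)"
    using edge[of i] edge[of t] st i by (auto simp: adjacent_def s_def insert_commute)
  moreover have "vs ! s \<noteq> vs ! t" using st cyc(1) by (simp add: nth_eq_iff_index_eq)
  ultimately show ?thesis using st(1,2) nth_mem by blast
qed

text \<open>
  Inner vertices of a thread have degree two, so \<open>S\<close> contains a thread as soon as it contains one of
  its inner vertices. Hence \<open>S\<close> contains the vertex \<open>0\<close>, whose two neighbours in \<open>S\<close> lie on
  different threads. The two full threads together have \<open>2 * n\<close> vertices.
\<close>

lemma theta_graph_min_degree_two:
  assumes "2 \<le> n" "finite S" "S \<subseteq> verts (theta_graph n N)" "S \<noteq> {}"
    and nbrs: "\<And>v. v \<in> S \<Longrightarrow> \<exists>u\<in>S. \<exists>w\<in>S. u \<noteq> w \<and>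
      adjacent (theta_graph n N) v u \<and> adjacent (theta_graph n N) v w"
  shows "2 * n \<le> card S"
proof -
  have inner: "node n j (i - 1) \<in> S \<and> node n j (Suc i) \<in> S"
    if "node n j i \<in> S" "0 < i" "i < n" for i j
  proof -
    have "w = node n j (i - 1) \<or> w = node n j (Suc i)"
      if "adjacent (theta_graph n N) (node n j i) w" for w
      using that \<open>0 < i\<close> \<open>i < n\<close> by (auto simp: adjacent_theta_graph_iff node_eq_iff)
    then show ?thesis using nbrs[OF that(1)] by metis
  qed
  have whole: "node n j i' \<in> S" if "node n j i \<in> S" "0 < i" "i < n" "i' \<le> n" for i i' j
  proof (cases "i \<le> i'")
    case True
    then show ?thesis using that(4)
    proof (induction i' rule: dec_induct)
      case base
      then show ?case using that by simp
    next
      case (step k)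
      then show ?case using inner[of j k] that by auto
    qed
  next
    case False
    then have "i' \<le> i" by simp
    then show ?thesis
    proof (induction i' rule: inc_induct)
      case base
      then show ?case using that by simp
    next
      case (step k)
      then show ?case using inner[of j "Suc k"] that by auto
    qed
  qed
  have nbr_0: "\<exists>j. w = node n j 1" if "adjacent (theta_graph n N) 0 w" for w
    using that assms(1) by (auto simp: adjacent_theta_graph_iff node_def split: if_splits)
  have nbr_1: "\<exists>j. w = node n j (n - 1)" if "adjacent (theta_graph n N) 1 w" for w
    using that assms(1) by (auto simp: adjacent_theta_graph_iff node_def split: if_splits)
  have "0 \<in> S"
  proof -
    obtain v where "v \<in> S" using assms(4) by blast
    then obtain j i where v: "node n j i \<in> S" "i \<le> n"
      using assms(3) by (auto simp: theta_graph_def)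
    consider "i = 0" | "0 < i" "i < n" | "i = n" using v(2) by linarith
    then show ?thesis
    proof cases
      case 1
      then show ?thesis using v by simp
    next
      case 2
      then show ?thesis using whole[OF v(1), of 0] by simp
    next
      case 3
      then have "1 \<in> S" using v assms(1) by simp
      from nbrs[OF this] obtain u where "u \<in> S" "adjacent (theta_graph n N) 1 u" by blast
      then obtain j' where "node n j' (n - 1) \<in> S" using nbr_1 by blast
      then show ?thesis using whole[of j' "n - 1" 0] assms(1) by simp
    qed
  qed
  from nbrs[OF this] obtain j j' where jj': "node n j 1 \<in> S" "node n j' 1 \<in> S" "j \<noteq> j'"
    using nbr_0 by metis
  let ?P = "node n j ` {..n}" and ?P' = "node n j' ` {1..<n}"
  have "card ?P = Suc n" "card ?P' = n - 1"
    using assms(1) by (subst card_image; auto simp: inj_on_def node_eq_iff)+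
  moreover have "?P \<inter> ?P' = {}" using jj'(3) assms(1) by (auto simp: node_eq_iff)
  ultimately have "card (?P \<union> ?P') = 2 * n"
    using assms(1) by (subst card_Un_disjoint) auto
  moreover have "?P \<union> ?P' \<subseteq> S" using whole[OF jj'(1)] whole[OF jj'(2)] assms(1) by auto
  ultimately show ?thesis using card_mono[OF assms(2)] by metis
qed

lemma girth_theta_graph:
  assumes "2 \<le> n"
  shows "enat (2 * n) \<le> girth (theta_graph n N)"
  unfolding girth_def
proof (rule INF_greatest)
  fix vs assume "vs \<in> {vs. is_cycle (theta_graph n N) vs}"
  then have vs: "is_cycle (theta_graph n N) vs" by simp
  have "card e = 2" if "e \<in># edges (theta_graph n N)" for e
    using that assms by (auto simp: theta_graph_def card_2_iff' node_eq_iff)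
  moreover have "count (edges (theta_graph n N)) e \<le> 1" for e
    unfolding theta_graph_edges_set[OF assms] by (simp add: count_mset_set')
  ultimately have "2 * n \<le> card (set vs)"
    using vs cycle_two_neighbours[OF vs] assms
    by (intro theta_graph_min_degree_two) (auto simp: is_cycle_def)
  also have "\<dots> = length vs" using vs by (auto simp: is_cycle_def distinct_card)
  finally show "enat (2 * n) \<le> enat (length vs)" by simp
qed

section \<open>The lower bound\<close>

text \<open>
  Inner vertex \<open>i\<close> of a thread with \<open>2 * q + 1\<close> edges gets the list consisting of blocks \<open>i\<close> and
  \<open>i + 1\<close>. The first and the last block are the sets whose simultaneous use at the two ends is to be
  excluded; the others consist of fresh colours, in intervals starting at different multiples of
  the list size \<open>2 * m + e\<close>.
\<close>

definition block :: "nat \<Rightarrow> nat \<Rightarrow> nat \<Rightarrow> nat set \<times> nat set \<Rightarrow> nat \<Rightarrow> nat set" where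
  "block q m e AB i = (if i = 1 then fst AB else if i = 2 * q + 1 then snd AB
    else {i * (2 * m + e)..<i * (2 * m + e) + (if even i then m + e else m)})"

definition bad_lists :: "nat \<Rightarrow> nat \<Rightarrow> nat \<Rightarrow> (nat set \<times> nat set) list \<Rightarrow> nat \<Rightarrow> nat set" where
  "bad_lists q m e ps v = (if v < 2 then {..<2 * m + e}
    else case prod_decode (v - 2) of (j, i) \<Rightarrow>
      block q m e (ps ! j) i \<union> block q m e (ps ! j) (Suc i))"

lemma bad_lists_node:
  assumes "0 < i" "i < n"
  shows "bad_lists q m e ps (node n j i) = block q m e (ps ! j) i \<union> block q m e (ps ! j) (Suc i)"
  using assms by (simp add: bad_lists_def node_def)

lemma card_block:
  assumes "card (fst AB) = m" "card (snd AB) = m"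
  shows "card (block q m e AB i) = (if even i then m + e else m)"
  using assms by (auto simp: block_def)

lemma finite_block:
  assumes "finite (fst AB)" "finite (snd AB)"
  shows "finite (block q m e AB i)"
  using assms by (auto simp: block_def)

lemma block_disjoint:
  assumes "fst AB \<subseteq> {..<2 * m + e}" "snd AB \<subseteq> {..<2 * m + e}" "0 < q" "0 < i"
  shows "block q m e AB i \<inter> block q m e AB (Suc i) = {}"
proof -
  let ?a = "2 * m + e"
  have fresh: "block q m e AB k \<subseteq> {k * ?a..<k * ?a + ?a}" if "k \<noteq> 1" "k \<noteq> 2 * q + 1" for k
    using that by (auto simp: block_def)
  have ends: "block q m e AB k \<subseteq> {..<?a}" if "k = 1 \<or> k = 2 * q + 1" for k
    using that assms by (auto simp: block_def)
  have beyond: "block q m e AB k \<subseteq> {?a..}" if "k \<noteq> 1" "k \<noteq> 2 * q + 1" "1 \<le> k" for k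
  proof -
    have "?a \<le> k * ?a" using that(3) by simp
    then have "{k * ?a..<k * ?a + ?a} \<subseteq> {?a..}"
      by (intro subsetI) (simp only: atLeastLessThan_iff atLeast_iff, linarith)
    then show ?thesis using fresh[OF that(1,2)] by blast
  qed
  consider "i = 1 \<or> i = 2 * q + 1" | "Suc i = 2 * q + 1" | "i \<noteq> 1" "i \<noteq> 2 * q + 1" "Suc i \<noteq> 2 * q + 1"
    by blast
  then show ?thesis
  proof cases
    case 1
    then have "Suc i \<noteq> 1" "Suc i \<noteq> 2 * q + 1" using assms(3,4) by auto
    then have "block q m e AB (Suc i) \<subseteq> {?a..}"
      by (intro beyond) auto
    moreover have "{..<?a} \<inter> {?a..} = {}" by auto
    ultimately show ?thesis using ends[OF 1] by blast
  next
    case 2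
    then have "i \<noteq> 1" "i \<noteq> 2 * q + 1" by presburger+
    then have "block q m e AB i \<subseteq> {?a..}"
      using assms(4) by (intro beyond) auto
    moreover have "{..<?a} \<inter> {?a..} = {}" by auto
    ultimately show ?thesis using ends[of "Suc i"] 2 by blast
  next
    case 3
    then have "block q m e AB i \<inter> block q m e AB (Suc i) \<subseteq>
        {i * ?a..<i * ?a + ?a} \<inter> {Suc i * ?a..<Suc i * ?a + ?a}"
      using assms(4) by (intro Int_mono fresh) auto
    also have "\<dots> = {}" by auto
    finally show ?thesis by simp
  qed
qed

text \<open>
  On the thread built for the colour sets that the two ends actually receive, vertex \<open>i\<close> uses at most
  \<open>(i div 2) * e\<close> colours of block \<open>i\<close>. Indeed its remaining colours come from block \<open>i + 1\<close> and
  are thereby forbidden for vertex \<open>i + 1\<close>; this leaves the same bound if that block has size \<open>m\<close>,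
  and a bound larger by \<open>e\<close> if it has size \<open>m + e\<close>. At the far end, whose set is the whole last
  block of size \<open>m\<close>, the bound is \<open>q * e < m\<close>.
\<close>

lemma theta_graph_not_choosable:
  assumes "0 < q" "q * e < m"
  shows "\<exists>N. \<not> choosable (theta_graph (2 * q + 1) (Suc N)) (2 * m + e) m"
proof -
  let ?n = "2 * q + 1" and ?a = "2 * m + e"
  let ?F = "{A. A \<subseteq> {..<?a} \<and> card A = m}"
  have finF: "finite (?F \<times> ?F)" by simp
  then obtain ps where ps: "set ps = ?F \<times> ?F" using finite_list[OF finF] by blast
  have "({..<m}, {..<m}) \<in> set ps" unfolding ps by auto
  then obtain N where N: "length ps = Suc N" by (cases ps) auto
  let ?G = "theta_graph ?n (Suc N)" and ?L = "bad_lists q m e ps"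
  have pair: "fst (ps ! j) \<subseteq> {..<?a}" "snd (ps ! j) \<subseteq> {..<?a}" "card (fst (ps ! j)) = m"
    "card (snd (ps ! j)) = m" if "j < Suc N" for j
    using that N ps nth_mem[of j ps] by (auto simp: mem_Times_iff)
  have fin: "finite (block q m e (ps ! j) i)" if "j < Suc N" for i j
    using pair[OF that] by (intro finite_block) (auto intro: finite_subset)
  have "finite (?L v) \<and> card (?L v) = ?a" if v: "v \<in> verts ?G" for v
  proof -
    obtain j i where ji: "j < Suc N" "i \<le> ?n" "v = node ?n j i"
      using v by (auto simp: theta_graph_def)
    show ?thesis
    proof (cases "0 < i \<and> i < ?n")
      case True
      then have "?L v = block q m e (ps ! j) i \<union> block q m e (ps ! j) (Suc i)"
        using ji(3) bad_lists_node by blast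
      moreover have "card (block q m e (ps ! j) i \<union> block q m e (ps ! j) (Suc i)) = ?a"
        using fin[OF ji(1)] True pair[OF ji(1)] assms(1) block_disjoint[of "ps ! j" m e q i]
        by (subst card_Un_disjoint) (auto simp: card_block)
      ultimately show ?thesis using fin[OF ji(1)] by simp
    next
      case False
      then have "v < 2" using ji by (auto simp: node_def)
      then show ?thesis by (simp add: bad_lists_def)
    qed
  qed
  then have "list_assignment ?G ?a ?L" by (simp add: list_assignment_def)
  moreover have "\<not> fold_list_colouring ?G m ?L \<phi>" for \<phi>
  proof
    assume \<phi>: "fold_list_colouring ?G m ?L \<phi>"
    have verts: "node ?n j i \<in> verts ?G" if "j < Suc N" "i \<le> ?n" for j i
      using that by (force simp: theta_graph_def)
    have col: "\<phi> v \<subseteq> ?L v" "finite (\<phi> v)" "card (\<phi> v) = m" if "v \<in> verts ?G" for v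
      using \<phi> that by (auto simp: fold_list_colouring_def fold_colouring_def)
    have disj: "\<phi> (node ?n j i) \<inter> \<phi> (node ?n j (Suc i)) = {}" if "j < Suc N" "i < ?n" for j i
    proof -
      have "adjacent ?G (node ?n j i) (node ?n j (Suc i))"
        using that by (auto simp: adjacent_theta_graph_iff)
      then show ?thesis
        using \<phi> verts[of j i] verts[of j "Suc i"] that
        by (auto simp: fold_list_colouring_def fold_colouring_def)
    qed
    have terminals: "0 \<in> verts ?G" "1 \<in> verts ?G" using verts[of 0 0] verts[of 0 ?n] by auto
    have "(\<phi> 0, \<phi> 1) \<in> set ps"
      using col[OF terminals(1)] col[OF terminals(2)] unfolding ps by (simp add: bad_lists_def)
    then obtain j where j: "j < Suc N" "ps ! j = (\<phi> 0, \<phi> 1)" using N by (metis in_set_conv_nth)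
    let ?S = "block q m e (ps ! j)" and ?C = "\<lambda>i. \<phi> (node ?n j i)"
    define bound where "bound i = (i div 2) * e" for i
    have "card (?C (Suc i) \<inter> ?S (Suc i)) \<le> bound (Suc i)" if "i < ?n" for i
      using that
    proof (induction i)
      case 0
      have "?S 1 = ?C 0" using j by (simp add: block_def)
      then have "?C 1 \<inter> ?S 1 = {}" using disj[OF j(1), of 0] by auto
      then show ?case by simp
    next
      case (Suc i)
      let ?i = "Suc i"
      have IH: "card (?C ?i \<inter> ?S ?i) \<le> bound ?i" using Suc by simp
      have "?C ?i \<subseteq> ?S ?i \<union> ?S (Suc ?i)"
        using col(1)[OF verts[OF j(1), of ?i]] bad_lists_node[of ?i ?n q m e ps j] Suc.prems by auto
      then have "?C ?i = (?C ?i \<inter> ?S ?i) \<union> (?C ?i \<inter> ?S (Suc ?i))" by blast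
      then have "m \<le> card (?C ?i \<inter> ?S ?i) + card (?C ?i \<inter> ?S (Suc ?i))"
        using col(3)[OF verts[OF j(1), of ?i]] Suc.prems by (metis card_Un_le less_imp_le)
      moreover have "card (?C ?i \<inter> ?S (Suc ?i)) + card (?C (Suc ?i) \<inter> ?S (Suc ?i)) \<le> card (?S (Suc ?i))"
      proof -
        have "card (?C ?i \<inter> ?S (Suc ?i)) + card (?C (Suc ?i) \<inter> ?S (Suc ?i)) =
            card ((?C ?i \<inter> ?S (Suc ?i)) \<union> (?C (Suc ?i) \<inter> ?S (Suc ?i)))"
          using disj[OF j(1) Suc.prems] fin[OF j(1)] by (intro card_Un_disjoint[symmetric]) auto
        also have "\<dots> \<le> card (?S (Suc ?i))" using fin[OF j(1)] by (intro card_mono) auto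
        finally show ?thesis .
      qed
      moreover have "card (?S (Suc ?i)) + bound ?i = m + bound (Suc ?i)"
      proof -
        have "bound (Suc ?i) = bound ?i + (if even (Suc ?i) then e else 0)"
          unfolding bound_def by (auto elim!: evenE oddE)
        moreover have "card (?S (Suc ?i)) = (if even (Suc ?i) then m + e else m)"
          using pair[OF j(1)] by (intro card_block)
        ultimately show ?thesis by (simp split: if_splits)
      qed
      ultimately show ?case using IH by linarith
    qed
    from this[of "2 * q"] have "card (?C ?n \<inter> ?S ?n) \<le> q * e" by (simp add: bound_def)
    moreover have "?C ?n = \<phi> 1" "?S ?n = \<phi> 1" using j assms(1) by (simp_all add: block_def)
    ultimately have "m \<le> q * e" using col(3)[OF terminals(2)] by simp
    then show False using assms(2) by simp
  qed
  ultimately show ?thesis unfolding choosable_def by blast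
qed

lemma choosable_mono:
  assumes "choosable G a b" "a \<le> a'"
  shows "choosable G a' b"
  unfolding choosable_def
proof (intro allI impI)
  fix L :: "'a \<Rightarrow> nat set"
  assume L: "list_assignment G a' L"
  have "\<exists>S\<subseteq>L v. finite S \<and> card S = a" if "v \<in> verts G" for v
    using L that assms(2) unfolding list_assignment_def
    by (metis finite_subset obtain_subset_with_card_n)
  then obtain L' where "\<forall>v\<in>verts G. L' v \<subseteq> L v \<and> finite (L' v) \<and> card (L' v) = a" by metis
  moreover from this obtain \<phi> where "fold_list_colouring G b L' \<phi>"
    using assms(1) by (auto simp: choosable_def list_assignment_def)
  ultimately have "fold_list_colouring G b L \<phi>" unfolding fold_list_colouring_def by blast
  then show "\<exists>\<phi>. fold_list_colouring G b L \<phi>" by blast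
qed

lemma strong_fractional_choice_number_ge:
  assumes "\<not> choosable G a m" "0 < m"
  shows "ereal (real a / real m) \<le> strong_fractional_choice_number G"
  unfolding strong_fractional_choice_number_def
proof (rule INF_greatest)
  fix r assume "r \<in> {r. strongly_fractional_choosable G r}"
  then have r: "choosable G (nat \<lceil>r * real m\<rceil>) m"
    using assms(2) by (auto simp: strongly_fractional_choosable_def)
  have "real a / real m \<le> r"
  proof (rule ccontr)
    assume "\<not> real a / real m \<le> r"
    then have "r * real m \<le> real a" using assms(2) by (simp add: field_simps)
    then have "nat \<lceil>r * real m\<rceil> \<le> a" by (simp add: ceiling_le_iff)
    then show False using choosable_mono[OF r] assms(1) by blast
  qed
  then show "ereal (real a / real m) \<le> ereal r" by simp
qed

theorem theorem1:
  fixes q k :: nat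
  assumes "q > 0"
    and "k \<in> {4 * q - 1, 4 * q, 4 * q + 1, 4 * q + 2}"
  shows "class_strong_fractional_choice_number (sp_girth_class k) = ereal (2 + 1 / real q)"
proof (rule antisym)
  show "class_strong_fractional_choice_number (sp_girth_class k) \<le> ereal (2 + 1 / real q)"
    unfolding class_strong_fractional_choice_number_def
  proof (rule SUP_least)
    fix G assume "G \<in> sp_girth_class k"
    then have G: "series_parallel G" "enat k \<le> girth G" by (auto simp: sp_girth_class_def)
    have "enat (4 * q - 1) \<le> enat k" using assms(2) by auto
    then have "enat (4 * q - 1) \<le> girth G" using G(2) by (rule order_trans)
    then have "strongly_fractional_choosable G (2 + 1 / real q)"
      using strongly_fractional_choosable_upper G(1) assms(1) by blast
    then show "strong_fractional_choice_number G \<le> ereal (2 + 1 / real q)"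
      unfolding strong_fractional_choice_number_def by (intro INF_lower) simp
  qed
next
  have bound: "ereal (2 + real M / (real q * real M + 1)) \<le>
      class_strong_fractional_choice_number (sp_girth_class k)" for M :: nat
  proof -
    \<comment> \<open>The least \<open>m\<close> with \<open>q * M < m\<close>.\<close>
    let ?m = "q * M + 1"
    obtain N where N: "\<not> choosable (theta_graph (2 * q + 1) (Suc N)) (2 * ?m + M) ?m"
      using theta_graph_not_choosable[of q M ?m] assms(1) by auto
    let ?G = "theta_graph (2 * q + 1) (Suc N)"
    have "enat k \<le> enat (2 * (2 * q + 1))" using assms(2) by auto
    also have "\<dots> \<le> girth ?G" using assms(1) by (intro girth_theta_graph) simp
    finally have "?G \<in> sp_girth_class k"
      using glued_sp_imp_series_parallel[OF glued_sp_theta_graph] by (simp add: sp_girth_class_def)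
    then have "strong_fractional_choice_number ?G \<le> class_strong_fractional_choice_number (sp_girth_class k)"
      unfolding class_strong_fractional_choice_number_def by (rule SUP_upper)
    moreover have "real ?m = real q * real M + 1" "real (2 * ?m + M) = 2 * real ?m + real M" by simp_all
    then have "real (2 * ?m + M) / real ?m = 2 + real M / (real q * real M + 1)"
      by (metis add_divide_distrib nonzero_mult_div_cancel_right of_nat_0_eq_iff Suc_eq_plus1 nat.distinct(2))
    ultimately show ?thesis
      using strong_fractional_choice_number_ge[OF N] by (metis order_trans zero_less_Suc Suc_eq_plus1)
  qed
  \<comment> \<open>The exact defect is \<open>1 / (q * (q * M + 1))\<close>; the coarser \<open>1 / (M + 1)\<close> tends to \<open>0\<close> as well.\<close>
  have defect: "ereal (2 + 1 / real q - inverse (real (Suc M))) \<le>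
      class_strong_fractional_choice_number (sp_girth_class k)" for M :: nat
  proof -
    define d where "d = real q * real M + 1"
    then have "0 < d" "real q * real M = d - 1" by (simp_all add: add_nonneg_pos)
    then have "real M / d = 1 / real q - inverse (real q * d)"
      using assms(1) by (simp add: divide_simps) (simp add: algebra_simps)
    then have "real M / (real q * real M + 1) = 1 / real q - inverse (real q * (real q * real M + 1))"
      unfolding d_def .
    moreover have "Suc M \<le> q * (q * M + 1)"
    proof -
      have "M \<le> q * (q * M)" using assms(1) by simp
      moreover have "q * (q * M + 1) = q * (q * M) + q" by (simp add: distrib_left)
      ultimately show ?thesis using assms(1) by linarith
    qed
    then have "real (Suc M) \<le> real (q * (q * M + 1))" by (simp only: of_nat_le_iff)
    then have "real (Suc M) \<le> real q * (real q * real M + 1)" by (simp add: algebra_simps)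
    then have "inverse (real q * (real q * real M + 1)) \<le> inverse (real (Suc M))"
      by (intro le_imp_inverse_le) auto
    ultimately show ?thesis using bound[of M] by (intro order_trans[OF _ bound[of M]]) simp
  qed
  have "(\<lambda>M. 2 + 1 / real q - inverse (real (Suc M))) \<longlonglongrightarrow> 2 + 1 / real q - 0"
    by (intro tendsto_intros LIMSEQ_inverse_real_of_nat)
  then have lim: "(\<lambda>M. ereal (2 + 1 / real q - inverse (real (Suc M)))) \<longlonglongrightarrow> ereal (2 + 1 / real q)"
    by (intro tendsto_ereal) simp
  show "ereal (2 + 1 / real q) \<le> class_strong_fractional_choice_number (sp_girth_class k)"
    using defect by (intro LIMSEQ_le_const2[OF lim]) blast
qed

end
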